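(* Let $f,g\in\mathbb{C}(z)$ be rational functions, with $f$ of degree $m>1$. The following conditions are equivalent: (1) $\int_{C(t)} g\equiv 0$ for every cycle $C(t)$ of $f$; (1') $\int_{C(t)} g\equiv 0$ for every simple cycle $C(t)$ of $f$; (2) there exists $g_0\in\mathbb{C}(z)$ such that $g=g_0\circ f$.
   Context: Let $f\in\mathbb{C}(z)$ have degree $m>1$, regarded as a map of the Riemann sphere, and let $\Sigma\subset\mathbb{C}$ be its set of (finite) critical values. For $t\in\mathbb{C}\setminus\Sigma$, $z_1(t),\dots,z_m(t)$ denote the $m$ distinct preimages in $f^{-1}(t)$, depending analytically on $t$ locally near a base point $t_0\notin\Sigma$ (and continued analytically along paths). A (zero-dimensional) cycle of $f$ is a formal sum $C(t)=\sum_{i=1}^m n_i z_i(t)$ with $n_i\in\mathbb{Z}$ and $\sum_{i=1}^m n_i=0$. It is simple if it has the form $z_j(t)-z_i(t)$. For $g\in\mathbb{C}(z)$, the zero-dimensional Abelian integral is $\int_{C(t)} g:=\sum_{i=1}^m n_i\, g(z_i(t))$; "$\equiv 0$" means it vanishes identically as a function of $t$. *)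

theory Defs
  imports
    "HOL-Complex_Analysis.Complex_Analysis"
    "HOL-Computational_Algebra.Computational_Algebra"
    "HOL-Computational_Algebra.Field_as_Ring"
begin

text \<open>Elements of \<open>\<complex>(z)\<close>. The function \<open>quot_of_fract\<close> returns the coprime pair
  (numerator, denominator) with monic denominator.\<close>

type_synonym ratfun = "complex poly fract"

text \<open>The Riemann sphere; \<open>None\<close> is the point at infinity.\<close>

type_synonym sphere = "complex option"

definition rat_num :: "ratfun \<Rightarrow> complex poly" where
  "rat_num f = fst (quot_of_fract f)"

definition rat_denom :: "ratfun \<Rightarrow> complex poly" where
  "rat_denom f = snd (quot_of_fract f)"

definition rat_degree :: "ratfun \<Rightarrow> nat" where
  "rat_degree f = max (degree (rat_num f)) (degree (rat_denom f))"

text \<open>The self-map of the Riemann sphere induced by a rational function. In the last line,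
  \<open>coeff p (degree q)\<close> is \<open>0\<close> when \<open>degree p < degree q\<close>.\<close>

definition rat_map :: "ratfun \<Rightarrow> sphere \<Rightarrow> sphere" where
  "rat_map f x =
     (let p = rat_num f; q = rat_denom f in
      case x of
        Some z \<Rightarrow> if poly q z = 0 then None else Some (poly p z / poly q z)
      | None \<Rightarrow> if degree p > degree q then None
                else Some (coeff p (degree q) / lead_coeff q))"

text \<open>The two standard parametrisations of the sphere are \<open>Some\<close> and the following one, which
  sends \<open>0\<close> to the point at infinity.\<close>

definition inv_chart :: "complex \<Rightarrow> sphere" where
  "inv_chart w = (if w = 0 then None else Some (inverse w))"

text \<open>Finite critical values: \<open>\<kappa> a\<close> is the critical point, and \<open>h\<close> is the expression of
  \<open>f\<close> in the parametrisation \<open>\<kappa>\<close> near it. The point at infinity may be critical.\<close>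

definition critical_values :: "ratfun \<Rightarrow> complex set" where
  "critical_values f =
     {t. \<exists>\<kappa>\<in>{Some, inv_chart}. \<exists>a h.
           (\<forall>\<^sub>F w in nhds a. rat_map f (\<kappa> w) = Some (h w)) \<and>
           (h has_field_derivative 0) (at a) \<and> h a = t}"

definition sphere_analytic_on :: "(complex \<Rightarrow> sphere) \<Rightarrow> complex set \<Rightarrow> bool" where
  "sphere_analytic_on \<zeta> U \<longleftrightarrow>
     (\<forall>t\<in>U. \<exists>\<kappa>\<in>{Some, inv_chart}. \<exists>h.
        h analytic_on {t} \<and> (\<forall>\<^sub>F s in nhds t. \<zeta> s = \<kappa> (h s)))"

text \<open>\<open>z 1 t, \<dots>, z m t\<close> are the \<open>m\<close> distinct points of the fibre of \<open>f\<close> (in the sphere) over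
  \<open>t\<close>, depending analytically on \<open>t\<close> in the connected open set \<open>U\<close>.\<close>

definition preimage_branches :: "ratfun \<Rightarrow> complex set \<Rightarrow> (nat \<Rightarrow> complex \<Rightarrow> sphere) \<Rightarrow> bool" where
  "preimage_branches f U z \<longleftrightarrow>
     open U \<and> connected U \<and> U \<subseteq> - critical_values f \<and>
     (\<forall>i\<in>{1..rat_degree f}. sphere_analytic_on (z i) U) \<and>
     (\<forall>t\<in>U. bij_betw (\<lambda>i. z i t) {1..rat_degree f} {x. rat_map f x = Some t})"

text \<open>\<open>(V s, w s)\<close>, for \<open>0 \<le> s \<le> 1\<close>, is an analytic continuation of \<open>(U, z)\<close> along the path
  \<open>\<gamma>\<close>.\<close>

definition branch_continuation ::
  "ratfun \<Rightarrow> complex set \<Rightarrow> (nat \<Rightarrow> complex \<Rightarrow> sphere) \<Rightarrow> (real \<Rightarrow> complex) \<Rightarrow>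
   (real \<Rightarrow> complex set) \<Rightarrow> (real \<Rightarrow> nat \<Rightarrow> complex \<Rightarrow> sphere) \<Rightarrow> bool" where
  "branch_continuation f U z \<gamma> V w \<longleftrightarrow>
     path \<gamma> \<and> path_image \<gamma> \<subseteq> - critical_values f \<and>
     V 0 = U \<and> w 0 = z \<and>
     (\<forall>s\<in>{0..1}. \<gamma> s \<in> V s \<and> preimage_branches f (V s) (w s)) \<and>
     (\<forall>s\<in>{0..1}. \<forall>\<^sub>F s' in at s within {0..1}. \<gamma> s' \<in> V s \<and>
        (\<forall>i\<in>{1..rat_degree f}. \<forall>\<^sub>F t in nhds (\<gamma> s'). w s' i t = w s i t))"

text \<open>A cycle \<open>n\<^sub>1 z\<^sub>1(t) + \<dots> + n\<^sub>m z\<^sub>m(t)\<close> is given by its coefficients with respect to labelled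
  branches.\<close>

definition is_cycle :: "nat \<Rightarrow> (nat \<Rightarrow> int) \<Rightarrow> bool" where
  "is_cycle m n \<longleftrightarrow> (\<Sum>i=1..m. n i) = 0"

definition is_simple_cycle :: "nat \<Rightarrow> (nat \<Rightarrow> int) \<Rightarrow> bool" where
  "is_simple_cycle m n \<longleftrightarrow>
     (\<exists>i\<in>{1..m}. \<exists>j\<in>{1..m}. \<forall>k\<in>{1..m}. n k = of_bool (k = j) - of_bool (k = i))"

text \<open>The value of the integral of \<open>g\<close> over \<open>n\<^sub>1 x\<^sub>1 + \<dots> + n\<^sub>m x\<^sub>m\<close>; meaningful only if no
  \<open>x\<^sub>i\<close> with \<open>n\<^sub>i \<noteq> 0\<close> is a pole of \<open>g\<close>.\<close>

definition abelian_integral :: "ratfun \<Rightarrow> nat \<Rightarrow> (nat \<Rightarrow> int) \<Rightarrow> (nat \<Rightarrow> sphere) \<Rightarrow> complex" where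
  "abelian_integral g m n x = (\<Sum>i=1..m. of_int (n i) * the (rat_map g (x i)))"

text \<open>The integral is a (multivalued) meromorphic function of \<open>t\<close>. It vanishes identically if
  every analytic continuation of it from the base point \<open>t\<^sub>0\<close> vanishes at all \<open>t\<close> where its terms
  are finite, the excluded values of \<open>t\<close> being isolated.\<close>

definition integral_vanishes ::
  "ratfun \<Rightarrow> complex \<Rightarrow> complex set \<Rightarrow> (nat \<Rightarrow> complex \<Rightarrow> sphere) \<Rightarrow> (nat \<Rightarrow> int) \<Rightarrow> ratfun \<Rightarrow> bool"
  where
  "integral_vanishes f t\<^sub>0 U z n g \<longleftrightarrow>
     (\<forall>\<gamma> V w. pathstart \<gamma> = t\<^sub>0 \<and> branch_continuation f U z \<gamma> V w \<longrightarrow>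
        (\<forall>s\<in>{0..1}. \<forall>t\<in>V s.
           (\<forall>i\<in>{1..rat_degree f}. n i \<noteq> 0 \<longrightarrow> rat_map g (w s i t) \<noteq> None) \<longrightarrow>
           abelian_integral g (rat_degree f) n (\<lambda>i. w s i t) = 0))"

end

theory Submission
  imports Defs
begin

text \<open>
  The substantial implication is that vanishing of all simple integrals makes \<open>g\<close> a rational function
  of \<open>f\<close>. If \<open>t\<^sub>0\<close> is not a critical value, the fibre of \<open>f\<close> over \<open>t\<^sub>0\<close> consists of \<open>m\<close> simple
  points, and the inverse function theorem gives \<open>m\<close> analytic branches over a disc around \<open>t\<^sub>0\<close>
  (\<open>preimage_branches_exist\<close>). Without moving away from this disc, the hypothesis already says
  that \<open>g\<close> takes a single value \<open>h t\<close> on the fibre over \<open>t\<close>, for all but finitely many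
  \<open>t\<close> of the disc.

  That \<open>h\<close> is rational follows by an argument in the style of Thue and Siegel
  (\<open>fibrewise_constant_imp_rational\<close>). Write \<open>f = p/q\<close> and \<open>g = P/Q\<close>, and let \<open>d\<close> be the degree of
  \<open>g\<close>. Linear algebra yields polynomials \<open>C, D\<close> of degree at most \<open>d\<close>, not both zero, with
  \<open>C(t) = h(t) D(t)\<close> at \<open>2 d + 1\<close> chosen points \<open>t\<close>. The polynomial
  \<open>q\<^sup>d (D(f) P - C(f) Q)\<close> has degree at most \<open>d m + d\<close> but vanishes on \<open>2 d + 1\<close> fibres
  of \<open>m\<close> points each, hence is zero. So \<open>g = (C/D) \<circ> f\<close> at infinitely many points.

  Infinitely many points suffice for an equality of maps of the sphere, since in homogeneous
  coordinates all the maps involved are given by polynomials (\<open>rat_map_comp_eqI\<close>).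

  The other implications hold at each single point of a continuation. Branches of the same fibre
  have the same value of \<open>g\<^sub>0 \<circ> f\<close>. If all simple integrals vanish, then \<open>g\<close> has a common value \<open>c\<close>
  on the points that carry a nonzero coefficient, and the integral is \<open>c\<close> times the sum of the
  coefficients, which is \<open>0\<close>.
\<close>

section \<open>Homogenised polynomials\<close>

text \<open>The form of degree \<open>n\<close> that dehomogenises to \<open>C\<close>, evaluated at the pair \<open>(A, B)\<close>. It
  computes \<open>B\<^sup>n C(A/B)\<close> without division and still has a meaning where \<open>B\<close> vanishes.\<close>

definition homogenize :: "nat \<Rightarrow> complex poly \<Rightarrow> complex poly \<Rightarrow> complex poly \<Rightarrow> complex poly" where
  "homogenize n C A B = (\<Sum>k\<le>n. smult (coeff C k) (A ^ k * B ^ (n - k)))"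

lemma poly_homogenize_finite:
  assumes "degree C \<le> n" "poly A w = t * poly B w"
  shows "poly (homogenize n C A B) w = poly B w ^ n * poly C t"
proof -
  have "poly (homogenize n C A B) w = (\<Sum>k\<le>n. coeff C k * ((t * poly B w) ^ k * poly B w ^ (n - k)))"
    by (simp add: homogenize_def poly_sum assms)
  also have "\<dots> = (\<Sum>k\<le>n. poly B w ^ n * (coeff C k * t ^ k))"
    by (intro sum.cong) (auto simp: power_mult_distrib simp flip: power_add)
  also have "\<dots> = poly B w ^ n * poly C t"
    using arg_cong[OF poly_as_sum_of_monoms'[OF assms(1)], of "\<lambda>X. poly X t"]
    by (simp add: poly_sum poly_monom flip: sum_distrib_left)
  finally show ?thesis .
qed

lemma poly_homogenize_infinite:
  assumes "poly B w = 0"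
  shows "poly (homogenize n C A B) w = coeff C n * poly A w ^ n"
proof -
  have "poly (homogenize n C A B) w = (\<Sum>k\<le>n. coeff C k * (poly A w ^ k * 0 ^ (n - k)))"
    by (simp add: homogenize_def poly_sum assms)
  also have "\<dots> = (\<Sum>k\<in>{n}. coeff C k * (poly A w ^ k * 0 ^ (n - k)))"
    by (intro sum.mono_neutral_right) auto
  finally show ?thesis by simp
qed

lemma degree_homogenize_le:
  assumes "degree A \<le> m" "degree B \<le> m"
  shows "degree (homogenize n C A B) \<le> n * m"
  unfolding homogenize_def
proof (intro degree_sum_le)
  fix k assume "k \<in> {..n}"
  have "degree (smult (coeff C k) (A ^ k * B ^ (n - k))) \<le> degree (A ^ k) + degree (B ^ (n - k))"
    using degree_mult_le degree_smult_le le_trans by blast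
  also have "\<dots> \<le> m * k + m * (n - k)"
    using assms by (intro add_mono order_trans[OF degree_power_le] mult_right_mono) auto
  also have "\<dots> = n * m" using \<open>k \<in> {..n}\<close> by (simp flip: add_mult_distrib2)
  finally show "degree (smult (coeff C k) (A ^ k * B ^ (n - k))) \<le> n * m" .
qed simp

lemma homogenize_diff_smult:
  "homogenize n (C - smult t D) A B = homogenize n C A B - smult t (homogenize n D A B)"
  by (intro poly_eqI)
     (simp add: homogenize_def coeff_sum sum_subtractf sum_distrib_left algebra_simps)

lemma coeff_homogenize_reverse:
  assumes "j \<le> n"
  shows "coeff (homogenize n C 1 [:0, 1:]) j = coeff C (n - j)"
proof -
  have "coeff (homogenize n C 1 [:0, 1:]) j = (\<Sum>k\<le>n. if k = n - j then coeff C k else 0)"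
    unfolding homogenize_def coeff_sum using assms
    by (intro sum.cong refl) (auto simp flip: monom_altdef)
  also have "\<dots> = coeff C (n - j)" by simp
  finally show ?thesis .
qed

lemma homogenize_identity:
  assumes "degree C \<le> n"
  shows "homogenize n C [:0, 1:] 1 = C"
proof -
  have "homogenize n C [:0, 1:] 1 = (\<Sum>k\<le>n. monom (coeff C k) k)"
    by (simp add: homogenize_def monom_altdef)
  also have "\<dots> = C" using assms by (rule poly_as_sum_of_monoms')
  finally show ?thesis .
qed

section \<open>Functions constant on fibres are rational\<close>

text \<open>By elimination of one unknown \<open>i0\<close> per equation; \<open>b\<close> is the system that remains.\<close>

lemma underdetermined_system_nontrivial:
  fixes a :: "'j \<Rightarrow> 'i \<Rightarrow> 'a::field"
  assumes "finite J" "finite I" "card J < card I"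
  shows "\<exists>v. (\<exists>i\<in>I. v i \<noteq> 0) \<and> (\<forall>j\<in>J. (\<Sum>i\<in>I. a j i * v i) = 0)"
  using assms
proof (induction J arbitrary: I a rule: finite_induct)
  case empty
  then obtain i where "i \<in> I" by fastforce
  then show ?case by (intro exI[of _ "\<lambda>_. 1"]) auto
next
  case (insert j J)
  show ?case
  proof (cases "\<forall>i\<in>I. a j i = 0")
    case True
    with insert show ?thesis by fastforce
  next
    case False
    then obtain i0 where i0: "i0 \<in> I" "a j i0 \<noteq> 0" by blast
    define b where "b k i = a k i - a k i0 * a j i / a j i0" for k i
    have "card J < card (I - {i0})" using insert.prems insert.hyps i0 by auto
    then obtain v where v: "\<exists>i\<in>I - {i0}. v i \<noteq> 0"
        "\<And>k. k \<in> J \<Longrightarrow> (\<Sum>i\<in>I - {i0}. b k i * v i) = 0"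
      using insert.IH[of "I - {i0}" b] insert.prems by blast
    define s where "s = (\<Sum>i\<in>I - {i0}. a j i * v i)"
    \<comment> \<open>the unknown \<open>i0\<close> is recovered by solving equation \<open>j\<close> for it\<close>
    define w where "w = v(i0 := - s / a j i0)"
    have sum_w: "(\<Sum>i\<in>I. a k i * w i) = (\<Sum>i\<in>I - {i0}. a k i * v i) - a k i0 * s / a j i0" for k
    proof -
      have "(\<Sum>i\<in>I. a k i * w i) = a k i0 * w i0 + (\<Sum>i\<in>I - {i0}. a k i * w i)"
        using i0 insert.prems by (subst sum.remove[of _ i0]) auto
      also have "(\<Sum>i\<in>I - {i0}. a k i * w i) = (\<Sum>i\<in>I - {i0}. a k i * v i)"
        by (intro sum.cong) (auto simp: w_def)
      finally show ?thesis by (simp add: w_def)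
    qed
    have "(\<Sum>i\<in>I. a k i * w i) = 0" if "k \<in> J" for k
    proof -
      have "0 = (\<Sum>i\<in>I - {i0}. a k i * v i - a k i0 / a j i0 * (a j i * v i))"
        using v(2)[OF that] by (simp add: b_def algebra_simps)
      also have "\<dots> = (\<Sum>i\<in>I - {i0}. a k i * v i) - a k i0 / a j i0 * s"
        by (simp add: sum_subtractf sum_distrib_left s_def)
      finally show ?thesis by (simp add: sum_w)
    qed
    moreover have "(\<Sum>i\<in>I. a j i * w i) = 0"
      unfolding sum_w using i0 by (simp add: s_def)
    moreover have "\<exists>i\<in>I. w i \<noteq> 0" using v(1) by (auto simp: w_def)
    ultimately show ?thesis by blast
  qed
qed

text \<open>Here \<open>h\<close> is the function that \<open>P/Q\<close> induces on the base of \<open>p/q\<close>, over the points of \<open>T\<close>. The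
  number of interpolation points \<open>2 * d + 1\<close> is one less than the number of coefficients of
  \<open>(C, D)\<close>, so a nonzero pair exists; and \<open>m * (2 * d + 1)\<close> exceeds the degree \<open>d * m + d\<close> of the
  polynomial \<open>E\<close>, which forces \<open>E = 0\<close>. Once \<open>E = 0\<close>, the interpolation condition holds on the
  whole of \<open>T\<close>.\<close>

lemma fibrewise_constant_imp_rational:
  fixes p q P Q :: "complex poly" and h :: "complex \<Rightarrow> complex"
  assumes deg: "degree p \<le> m" "degree q \<le> m" and "m > 0" and T: "infinite T"
    and card: "\<And>t. t \<in> T \<Longrightarrow> card {z. poly p z = t * poly q z} = m"
    and nz: "\<And>t z. t \<in> T \<Longrightarrow> poly p z = t * poly q z \<Longrightarrow> poly q z \<noteq> 0"
            "\<And>t z. t \<in> T \<Longrightarrow> poly p z = t * poly q z \<Longrightarrow> poly Q z \<noteq> 0"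
    and h: "\<And>t z. t \<in> T \<Longrightarrow> poly p z = t * poly q z \<Longrightarrow> poly P z = h t * poly Q z"
  shows "\<exists>C D. D \<noteq> 0 \<and> (\<forall>t\<in>T. poly C t = h t * poly D t)"
proof -
  define d where "d = max (degree P) (degree Q)"
  define R where "R t = {z. poly p z = t * poly q z}" for t
  have finR: "finite (R t)" if "t \<in> T" for t
    using card[OF that] \<open>m > 0\<close> by (auto simp: R_def intro: card_ge_0_finite)
  obtain S where S: "S \<subseteq> T" "finite S" "card S = 2 * d + 1"
    using infinite_arbitrarily_large[OF T] by blast
  define a where "a t = case_sum (\<lambda>k. h t * t ^ k) (\<lambda>k. - (t ^ k))" for t and k :: "nat + nat"
  obtain v where v: "\<exists>i\<in>{..d} <+> {..d}. v i \<noteq> 0"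
      "\<And>t. t \<in> S \<Longrightarrow> (\<Sum>i\<in>{..d} <+> {..d}. a t i * v i) = 0"
    using underdetermined_system_nontrivial[of S "{..d} <+> {..d}" a] S
    by (auto simp: card_Plus)
  define D where "D = (\<Sum>k\<le>d. monom (v (Inl k)) k)"
  define C where "C = (\<Sum>k\<le>d. monom (v (Inr k)) k)"
  have degD: "degree D \<le> d" and degC: "degree C \<le> d"
    unfolding D_def C_def by (auto intro!: degree_sum_le order_trans[OF degree_monom_le])
  have CD_S: "poly C t = h t * poly D t" if "t \<in> S" for t
    using v(2)[OF that]
    by (simp add: sum.Plus a_def C_def D_def poly_sum poly_monom sum_distrib_left sum_negf
          algebra_simps)
  define E where "E = homogenize d D p q * P - homogenize d C p q * Q"
  have poly_E: "poly E z = poly q z ^ d * poly Q z * (h t * poly D t - poly C t)"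
    if "t \<in> T" "z \<in> R t" for t z
    using that h[of t z] poly_homogenize_finite[OF degD, of p z t q]
      poly_homogenize_finite[OF degC, of p z t q]
    by (simp add: E_def R_def algebra_simps)
  \<comment> \<open>too many zeros for the degree: \<open>E\<close> vanishes on the \<open>2 * d + 1\<close> fibres over \<open>S\<close>\<close>
  have "degree E \<le> d * m + d"
  proof -
    have "degree (homogenize d G p q * H) \<le> d * m + d" if "degree H \<le> d" for G H
      using degree_homogenize_le[OF deg, of d G] degree_mult_le[of "homogenize d G p q" H] that
      by linarith
    then show ?thesis unfolding E_def by (intro degree_diff_le) (auto simp: d_def)
  qed
  moreover have "card {z. poly E z = 0} > d * m + d" if "E \<noteq> 0"
  proof -
    have "card (\<Union>t\<in>S. R t) = (\<Sum>t\<in>S. card (R t))"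
    proof (intro card_UN_disjoint ballI impI)
      fix t t' assume "t \<in> S" "t' \<in> S" "t \<noteq> t'"
      then show "R t \<inter> R t' = {}" using nz(1) S by (auto simp: R_def)
    qed (use S finR in auto)
    also have "\<dots> = (\<Sum>t\<in>S. m)" using S card by (intro sum.cong) (auto simp: R_def)
    also have "\<dots> = (2 * d + 1) * m" using S by simp
    finally have "card (\<Union>t\<in>S. R t) = (2 * d + 1) * m" .
    moreover have "(\<Union>t\<in>S. R t) \<subseteq> {z. poly E z = 0}"
      using poly_E CD_S S by (auto simp: subset_iff)
    ultimately have "(2 * d + 1) * m \<le> card {z. poly E z = 0}"
      using card_mono[OF poly_roots_finite[OF that]] by metis
    moreover have "d * m + d < (2 * d + 1) * m"
      using \<open>m > 0\<close> by (cases m) auto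
    ultimately show ?thesis by linarith
  qed
  ultimately have "E = 0" using card_poly_roots_bound[of E] by fastforce
  have CD_T: "poly C t = h t * poly D t" if "t \<in> T" for t
  proof -
    have "R t \<noteq> {}" using card[OF that] \<open>m > 0\<close> unfolding R_def by (metis card.empty less_irrefl)
    then obtain z where z: "z \<in> R t" by blast
    with poly_E[OF that z] nz[OF that, of z] \<open>E = 0\<close> show ?thesis by (auto simp: R_def)
  qed
  moreover have "D \<noteq> 0"
  proof
    assume "D = 0"
    then have "T \<subseteq> {t. poly C t = 0}" using CD_T by auto
    then have "C = 0" using T poly_roots_finite finite_subset by blast
    have "v (Inl k) = 0" if "k \<le> d" for k
      using arg_cong[OF \<open>D = 0\<close>, of "\<lambda>X. coeff X k"] that by (simp add: D_def coeff_sum)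
    moreover have "v (Inr k) = 0" if "k \<le> d" for k
      using arg_cong[OF \<open>C = 0\<close>, of "\<lambda>X. coeff X k"] that by (simp add: C_def coeff_sum)
    ultimately show False using v(1) by auto
  qed
  ultimately show ?thesis by blast
qed

section \<open>Homogeneous coordinates on the sphere\<close>

text \<open>The point with homogeneous coordinates \<open>[u : v]\<close>.\<close>

definition proj :: "complex \<Rightarrow> complex \<Rightarrow> sphere" where
  "proj u v = (if v = 0 then None else Some (u / v))"

lemma proj_eq_iff:
  assumes "u \<noteq> 0 \<or> v \<noteq> 0" "u' \<noteq> 0 \<or> v' \<noteq> 0"
  shows "proj u v = proj u' v' \<longleftrightarrow> u * v' = u' * v"
  using assms by (auto simp: proj_def field_simps)

lemma rat_coprime: "coprime (rat_num f) (rat_denom f)"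
  by (simp add: rat_num_def rat_denom_def coprime_quot_of_fract)

lemma rat_denom_nonzero [simp]: "rat_denom f \<noteq> 0"
  by (simp add: rat_denom_def)

lemma degree_rat_num: "degree (rat_num f) \<le> rat_degree f"
  and degree_rat_denom: "degree (rat_denom f) \<le> rat_degree f"
  by (auto simp: rat_degree_def)

lemma rat_no_common_root: "poly (rat_num f) z \<noteq> 0 \<or> poly (rat_denom f) z \<noteq> 0"
  using coprime_poly_0[OF rat_coprime] by blast

text \<open>In homogeneous coordinates a rational map is given by a pair of forms of the same degree, and
  coprimality keeps them from vanishing simultaneously. Working along polynomials \<open>A, B\<close> in a
  variable \<open>w\<close> treats both charts of the sphere at once.\<close>

lemma rat_map_proj:
  fixes f A B w
  defines "F \<equiv> homogenize (rat_degree f) (rat_num f) A B"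
    and "G \<equiv> homogenize (rat_degree f) (rat_denom f) A B"
  assumes nz: "poly A w \<noteq> 0 \<or> poly B w \<noteq> 0"
  shows "poly F w \<noteq> 0 \<or> poly G w \<noteq> 0"
    and "rat_map f (proj (poly A w) (poly B w)) = proj (poly F w) (poly G w)"
proof -
  have "(poly F w \<noteq> 0 \<or> poly G w \<noteq> 0) \<and>
    rat_map f (proj (poly A w) (poly B w)) = proj (poly F w) (poly G w)"
  proof (cases "poly B w = 0")
    case False
    define z where "z = poly A w / poly B w"
    have "poly A w = z * poly B w" using False by (simp add: z_def)
    then have "poly F w = poly B w ^ rat_degree f * poly (rat_num f) z"
      "poly G w = poly B w ^ rat_degree f * poly (rat_denom f) z"
      unfolding F_def G_def by (auto intro: poly_homogenize_finite degree_rat_num degree_rat_denom)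
    then show ?thesis using False rat_no_common_root[of f z]
      by (auto simp: proj_def z_def rat_map_def Let_def)
  next
    case True
    then have A: "poly A w \<noteq> 0" using nz by blast
    have FG: "poly F w = coeff (rat_num f) (rat_degree f) * poly A w ^ rat_degree f"
      "poly G w = coeff (rat_denom f) (rat_degree f) * poly A w ^ rat_degree f"
      unfolding F_def G_def using True by (auto intro: poly_homogenize_infinite)
    show ?thesis
    proof (cases "degree (rat_num f) > degree (rat_denom f)")
      case gt: True
      then have "rat_degree f = degree (rat_num f)" "coeff (rat_denom f) (rat_degree f) = 0"
        by (auto simp: rat_degree_def coeff_eq_0)
      moreover have "lead_coeff (rat_num f) \<noteq> 0" using gt by auto
      ultimately show ?thesis using A FG True gt by (auto simp: proj_def rat_map_def Let_def)
    next
      case False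
      then have "rat_degree f = degree (rat_denom f)" by (auto simp: rat_degree_def)
      then show ?thesis using A FG True False by (auto simp: proj_def rat_map_def Let_def)
    qed
  qed
  then show "poly F w \<noteq> 0 \<or> poly G w \<noteq> 0"
    and "rat_map f (proj (poly A w) (poly B w)) = proj (poly F w) (poly G w)" by auto
qed

text \<open>A polynomial parametrisation of a rational curve in the sphere. Both charts are of this kind,
  and the class is closed under rational maps, so that statements about maps of the sphere become polynomial
  identities.\<close>

definition poly_curve :: "(complex \<Rightarrow> sphere) \<Rightarrow> bool" where
  "poly_curve \<phi> \<longleftrightarrow> (\<exists>A B. \<forall>w. (poly A w \<noteq> 0 \<or> poly B w \<noteq> 0) \<and> \<phi> w = proj (poly A w) (poly B w))"

lemma poly_curve_rat_map:
  assumes "poly_curve \<phi>"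
  shows "poly_curve (rat_map f \<circ> \<phi>)"
  using assms rat_map_proj[of _ _ _ f] unfolding poly_curve_def comp_def by metis

lemma Some_eq_proj: "Some z = proj (poly [:0, 1:] z) (poly 1 z)"
  by (simp add: proj_def)

lemma inv_chart_eq_proj: "inv_chart w = proj (poly 1 w) (poly [:0, 1:] w)"
  by (simp add: proj_def inv_chart_def inverse_eq_divide)

lemma inv_chart_0 [simp]: "inv_chart 0 = None"
  by (simp add: inv_chart_def)

lemma poly_curve_Some: "poly_curve Some"
  unfolding poly_curve_def using Some_eq_proj by (metis poly_1 zero_neq_one)

lemma poly_curve_inv_chart: "poly_curve inv_chart"
  unfolding poly_curve_def using inv_chart_eq_proj by (metis poly_1 zero_neq_one)

text \<open>Two such curves agree exactly where the polynomial \<open>A D - C B\<close> vanishes.\<close>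

lemma poly_curve_identity:
  assumes "poly_curve \<phi>" "poly_curve \<psi>" "infinite {w. \<phi> w = \<psi> w}"
  shows "\<phi> = \<psi>"
proof -
  obtain A B where AB: "\<And>w. poly A w \<noteq> 0 \<or> poly B w \<noteq> 0" "\<And>w. \<phi> w = proj (poly A w) (poly B w)"
    using assms(1) unfolding poly_curve_def by blast
  obtain C D where CD: "\<And>w. poly C w \<noteq> 0 \<or> poly D w \<noteq> 0" "\<And>w. \<psi> w = proj (poly C w) (poly D w)"
    using assms(2) unfolding poly_curve_def by blast
  have eq: "\<phi> w = \<psi> w \<longleftrightarrow> poly (A * D - C * B) w = 0" for w
    using proj_eq_iff[OF AB(1) CD(1), of w w] AB(2) CD(2) by simp
  then have "A * D - C * B = 0" using assms(3) poly_roots_finite unfolding eq by blast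
  then show ?thesis using eq by auto
qed

text \<open>The identity principle for rational maps. The equality spreads from infinitely many points to
  the chart \<open>Some\<close>, hence to the punctured chart at infinity, hence to infinity.\<close>

lemma rat_map_comp_eqI:
  assumes "infinite {z. rat_map g (Some z) = rat_map k (rat_map f (Some z))}"
  shows "rat_map g = rat_map k \<circ> rat_map f"
proof -
  have Some: "rat_map g \<circ> Some = rat_map k \<circ> (rat_map f \<circ> Some)"
    using assms
    by (intro poly_curve_identity poly_curve_rat_map poly_curve_Some) (auto simp: comp_def)
  have "rat_map g (inv_chart w) = rat_map k (rat_map f (inv_chart w))" if "w \<noteq> 0" for w
    using fun_cong[OF Some, of "inverse w"] that by (simp add: inv_chart_def)
  then have "- {0} \<subseteq> {w. (rat_map g \<circ> inv_chart) w = (rat_map k \<circ> (rat_map f \<circ> inv_chart)) w}"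
    by auto
  moreover have "infinite (- {0 :: complex})"
    by (metis finite_compl finite.intros infinite_UNIV_char_0)
  ultimately have "rat_map g \<circ> inv_chart = rat_map k \<circ> (rat_map f \<circ> inv_chart)"
    by (intro poly_curve_identity poly_curve_rat_map poly_curve_inv_chart)
       (auto dest: finite_subset)
  then have "rat_map g None = rat_map k (rat_map f None)"
    by (auto simp: inv_chart_def dest: fun_cong[of _ _ 0])
  moreover have "rat_map g (Some z) = rat_map k (rat_map f (Some z))" for z
    using fun_cong[OF Some] by simp
  ultimately show ?thesis by (metis comp_apply not_None_eq ext)
qed


section \<open>Fibres and critical values\<close>

text \<open>The finite points of the fibre over \<open>t\<close> are the roots of this polynomial. Regarded as a form of
  degree \<open>rat_degree f\<close>, it vanishes at infinity exactly if infinity lies in the fibre.\<close>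

definition fibre_poly :: "ratfun \<Rightarrow> complex \<Rightarrow> complex poly" where
  "fibre_poly f t = rat_num f - smult t (rat_denom f)"

lemma degree_fibre_poly: "degree (fibre_poly f t) \<le> rat_degree f"
  unfolding fibre_poly_def
  by (intro degree_diff_le degree_rat_num order_trans[OF degree_smult_le degree_rat_denom])

lemma fibre_poly_nonzero:
  assumes "rat_degree f > 0"
  shows "fibre_poly f t \<noteq> 0"
proof
  assume "fibre_poly f t = 0"
  then have num: "rat_num f = smult t (rat_denom f)" by (simp add: fibre_poly_def)
  then have "rat_denom f dvd rat_num f" by (simp add: dvd_smult)
  then have "is_unit (rat_denom f)" using rat_coprime[of f] by (meson coprime_common_divisor dvd_refl)
  then have "degree (rat_denom f) = 0" by (simp add: is_unit_iff_degree)
  moreover from this have "degree (rat_num f) = 0" using num by simp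
  ultimately show False using assms by (simp add: rat_degree_def)
qed

lemma rat_map_proj_eq_Some_iff:
  assumes "poly A w \<noteq> 0 \<or> poly B w \<noteq> 0"
  shows "rat_map f (proj (poly A w) (poly B w)) = Some t \<longleftrightarrow>
    poly (homogenize (rat_degree f) (fibre_poly f t) A B) w = 0"
  using rat_map_proj[OF assms, of f]
  by (auto simp: fibre_poly_def homogenize_diff_smult proj_def field_simps)

lemma rat_map_Some_eq_iff: "rat_map f (Some z) = Some t \<longleftrightarrow> poly (fibre_poly f t) z = 0"
  using rat_map_proj_eq_Some_iff[of "[:0, 1:]" z 1 f t]
  by (simp add: homogenize_identity degree_fibre_poly proj_def)

lemma rat_map_None_eq_iff:
  "rat_map f None = Some t \<longleftrightarrow> coeff (fibre_poly f t) (rat_degree f) = 0"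
  using rat_map_proj_eq_Some_iff[of 1 0 0 f t]
  by (simp add: poly_homogenize_infinite proj_def)

lemma fibre_eq:
  "{x. rat_map f x = Some t} = Some ` {z. poly (fibre_poly f t) z = 0} \<union>
     (if coeff (fibre_poly f t) (rat_degree f) = 0 then {None} else {})"
proof -
  have "rat_map f x = Some t \<longleftrightarrow> x \<in> Some ` {z. poly (fibre_poly f t) z = 0} \<union>
     (if coeff (fibre_poly f t) (rat_degree f) = 0 then {None} else {})" for x
    by (cases x) (auto simp: rat_map_Some_eq_iff rat_map_None_eq_iff)
  then show ?thesis by blast
qed

lemma finite_fibre:
  assumes "rat_degree f > 0"
  shows "finite {x. rat_map f x = Some t}"
  using fibre_poly_nonzero[OF assms] by (simp add: fibre_eq poly_roots_finite)

lemma card_fibre_eq: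
  assumes "rat_degree f > 0"
  shows "card {x. rat_map f x = Some t} =
    card {z. poly (fibre_poly f t) z = 0} + of_bool (coeff (fibre_poly f t) (rat_degree f) = 0)"
  unfolding fibre_eq using fibre_poly_nonzero[OF assms]
  by (subst card_Un_disjoint) (auto simp: card_image poly_roots_finite)

lemma degree_less_of_coeff_0:
  assumes "degree p \<le> n" "coeff p n = 0" "p \<noteq> 0"
  shows "degree p < n"
  using assms by (metis le_neq_implies_less leading_coeff_0_iff)

lemma card_fibre_le:
  assumes "rat_degree f > 0"
  shows "card {x. rat_map f x = Some t} \<le> rat_degree f"
  using card_poly_roots_bound[OF fibre_poly_nonzero[OF assms, of t]] degree_fibre_poly[of f t]
    degree_less_of_coeff_0[OF degree_fibre_poly _ fibre_poly_nonzero[OF assms, of t]]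
  by (cases "coeff (fibre_poly f t) (rat_degree f) = 0") (auto simp: card_fibre_eq[OF assms])

text \<open>In a chart, \<open>f\<close> is a quotient \<open>F/G\<close>. Since \<open>F = t G\<close> at the point \<open>a\<close>, the quotient rule gives
  the derivative \<open>(F - t G)'(a) / G(a)\<close>, so \<open>a\<close> is critical if and only if it is a multiple
  zero of the form defining the fibre.\<close>

lemma chart_expression:
  assumes nz: "\<And>w. poly A w \<noteq> 0 \<or> poly B w \<noteq> 0"
    and \<kappa>: "\<And>w. \<kappa> w = proj (poly A w) (poly B w)" and t: "rat_map f (\<kappa> a) = Some t"
  obtains S h c where "open S" "a \<in> S" "h holomorphic_on S"
    "\<And>w. w \<in> S \<Longrightarrow> rat_map f (\<kappa> w) = Some (h w)" "h a = t" "c \<noteq> 0"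
    "(h has_field_derivative
       poly (pderiv (homogenize (rat_degree f) (fibre_poly f t) A B)) a / c) (at a)"
proof -
  define F where "F = homogenize (rat_degree f) (rat_num f) A B"
  define G where "G = homogenize (rat_degree f) (rat_denom f) A B"
  define h where "h w = poly F w / poly G w" for w
  define S where "S = {w. poly G w \<noteq> 0}"
  have val: "rat_map f (\<kappa> w) = proj (poly F w) (poly G w)" for w
    using rat_map_proj(2)[OF nz] by (simp add: F_def G_def \<kappa>)
  have "open S" unfolding S_def by (intro open_Collect_neq continuous_intros)
  moreover have Ga: "poly G a \<noteq> 0" and ha: "h a = t"
    using t val[of a] by (auto simp: proj_def h_def split: if_splits)
  moreover have "h holomorphic_on S"
    unfolding h_def S_def by (intro holomorphic_intros) auto
  moreover have "rat_map f (\<kappa> w) = Some (h w)" if "w \<in> S" for w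
    using that by (simp add: val S_def proj_def h_def)
  moreover have "(h has_field_derivative
       poly (pderiv (homogenize (rat_degree f) (fibre_poly f t) A B)) a / poly G a) (at a)"
  proof -
    have Fa: "poly F a = t * poly G a" using ha Ga by (simp add: h_def field_simps)
    have "poly (pderiv (homogenize (rat_degree f) (fibre_poly f t) A B)) a =
        poly (pderiv F) a - t * poly (pderiv G) a"
      by (simp add: fibre_poly_def homogenize_diff_smult F_def G_def pderiv_diff pderiv_smult)
    then show ?thesis unfolding h_def using Ga
      by (auto intro!: derivative_eq_intros simp: Fa field_simps)
  qed
  ultimately show thesis using that[of S h "poly G a"] by (simp add: S_def)
qed

lemma noncritical_simple_root:
  assumes "t \<notin> critical_values f" "\<kappa> \<in> {Some, inv_chart}"
    and nz: "\<And>w. poly A w \<noteq> 0 \<or> poly B w \<noteq> 0"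
    and \<kappa>: "\<And>w. \<kappa> w = proj (poly A w) (poly B w)" and t: "rat_map f (\<kappa> a) = Some t"
  shows "poly (pderiv (homogenize (rat_degree f) (fibre_poly f t) A B)) a \<noteq> 0"
proof
  assume 0: "poly (pderiv (homogenize (rat_degree f) (fibre_poly f t) A B)) a = 0"
  obtain S h c where *: "open S" "a \<in> S" "h holomorphic_on S"
    "\<And>w. w \<in> S \<Longrightarrow> rat_map f (\<kappa> w) = Some (h w)" "h a = t" "c \<noteq> 0"
    "(h has_field_derivative
       poly (pderiv (homogenize (rat_degree f) (fibre_poly f t) A B)) a / c) (at a)"
    using chart_expression[OF nz \<kappa> t] by metis
  then have "\<forall>\<^sub>F w in nhds a. rat_map f (\<kappa> w) = Some (h w)"
    using eventually_nhds by blast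
  then have "t \<in> critical_values f"
    unfolding critical_values_def using * 0 assms(2) by auto
  with assms(1) show False by simp
qed

lemma chart_polys:
  "poly 1 w \<noteq> (0::complex) \<or> poly [:0, 1:] w \<noteq> 0" "poly [:0, 1:] w \<noteq> 0 \<or> poly 1 w \<noteq> (0::complex)"
  by simp_all

lemma pderiv_0_coeff: "poly (pderiv p) 0 = coeff p 1"
  by (simp add: poly_0_coeff_0 coeff_pderiv)

lemma card_roots_rsquarefree:
  fixes p :: "complex poly"
  assumes "rsquarefree p"
  shows "card {z. poly p z = 0} = degree p"
proof -
  have "p \<noteq> 0" using assms by (simp add: rsquarefree_def)
  have "degree p = degree (\<Prod>z|poly p z = 0. [:- z, 1:])"
    using complex_poly_decompose_rsquarefree[OF assms] \<open>p \<noteq> 0\<close>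
    by (metis degree_smult_eq leading_coeff_0_iff)
  also have "\<dots> = card {z. poly p z = 0}" by (simp add: degree_prod_eq_sum_degree)
  finally show ?thesis by simp
qed

text \<open>Simple finite roots are as many as the degree of \<open>fibre_poly f t\<close>. If infinity is in the fibre,
  then its simplicity means that this degree is \<open>rat_degree f - 1\<close>, and infinity is the
  missing point.\<close>

lemma card_fibre_noncritical:
  assumes "rat_degree f > 0" "t \<notin> critical_values f"
  shows "card {x. rat_map f x = Some t} = rat_degree f"
proof -
  define m F where "m = rat_degree f" and "F = fibre_poly f t"
  have "F \<noteq> 0" "degree F \<le> m"
    by (simp_all add: F_def m_def fibre_poly_nonzero assms degree_fibre_poly)
  have "poly (pderiv F) a \<noteq> 0" if "poly F a = 0" for a
    using noncritical_simple_root[OF assms(2) _ chart_polys(2) Some_eq_proj, of a] that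
    by (simp add: rat_map_Some_eq_iff F_def homogenize_identity degree_fibre_poly)
  then have "rsquarefree F" by (auto simp: rsquarefree_roots)
  then have roots: "card {z. poly F z = 0} = degree F" by (rule card_roots_rsquarefree)
  show ?thesis
  proof (cases "coeff F m = 0")
    case True
    have "coeff F (m - 1) \<noteq> 0"
      using noncritical_simple_root[OF assms(2) _ chart_polys(1) inv_chart_eq_proj, of 0] True assms(1)
      by (simp add: rat_map_None_eq_iff F_def m_def pderiv_0_coeff coeff_homogenize_reverse)
    then have "m - 1 \<le> degree F" by (rule le_degree)
    moreover have "degree F < m"
      using degree_less_of_coeff_0 \<open>degree F \<le> m\<close> True \<open>F \<noteq> 0\<close> by blast
    ultimately have "degree F + 1 = m" by simp
    then show ?thesis using True roots by (simp add: card_fibre_eq[OF assms(1)] F_def m_def)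
  next
    case False
    then have "degree F = m" using le_degree[OF False] \<open>degree F \<le> m\<close> by simp
    then show ?thesis using False roots by (simp add: card_fibre_eq[OF assms(1)] F_def m_def)
  qed
qed

text \<open>The chart at infinity matters only at infinity itself: a critical point at a nonzero parameter
  of \<open>inv_chart\<close> is transported to the chart \<open>Some\<close> by the chain rule.\<close>

lemma critical_value_cases:
  assumes "t \<in> critical_values f"
  obtains a where "poly (fibre_poly f t) a = 0" "poly (pderiv (fibre_poly f t)) a = 0"
  | "coeff (fibre_poly f t) (rat_degree f) = 0" "coeff (fibre_poly f t) (rat_degree f - 1) = 0"
proof -
  note conclude = that
  have critical: "poly (pderiv (homogenize (rat_degree f) (fibre_poly f t) A B)) a = 0"
    if nz: "\<And>w. poly A w \<noteq> 0 \<or> poly B w \<noteq> 0" and \<kappa>: "\<And>w. \<kappa> w = proj (poly A w) (poly B w)"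
      and ev: "\<forall>\<^sub>F w in nhds a. rat_map f (\<kappa> w) = Some (h w)"
      and "(h has_field_derivative 0) (at a)" "h a = t"
    for A B \<kappa> a h
  proof -
    have t: "rat_map f (\<kappa> a) = Some t" using eventually_nhds_x_imp_x[OF ev] \<open>h a = t\<close> by simp
    obtain S k c where k: "open S" "a \<in> S" "\<And>w. w \<in> S \<Longrightarrow> rat_map f (\<kappa> w) = Some (k w)" "c \<noteq> 0"
      "(k has_field_derivative
         poly (pderiv (homogenize (rat_degree f) (fibre_poly f t) A B)) a / c) (at a)"
      using chart_expression[OF nz \<kappa> t] by metis
    have "\<forall>\<^sub>F w in nhds a. w \<in> S" using k eventually_nhds_in_open by blast
    with ev have "\<forall>\<^sub>F w in nhds a. k w = h w" by eventually_elim (use k in auto)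
    then have "(k has_field_derivative 0) (at a)"
      using that(4) DERIV_cong_ev[OF refl _ refl] by blast
    from DERIV_unique[OF this k(5)] show ?thesis using k(4) by simp
  qed
  have finite_case: thesis
    if "\<forall>\<^sub>F w in nhds a. rat_map f (Some w) = Some (h w)" "(h has_field_derivative 0) (at a)" "h a = t"
    for a h
  proof (rule conclude(1))
    have "rat_map f (Some a) = Some t" using eventually_nhds_x_imp_x[OF that(1)] that(3) by simp
    then show "poly (fibre_poly f t) a = 0" by (simp add: rat_map_Some_eq_iff)
    show "poly (pderiv (fibre_poly f t)) a = 0"
      using critical[OF chart_polys(2) Some_eq_proj that]
      by (simp add: homogenize_identity degree_fibre_poly)
  qed
  obtain \<kappa> a h where h: "\<kappa> \<in> {Some, inv_chart}" "\<forall>\<^sub>F w in nhds a. rat_map f (\<kappa> w) = Some (h w)"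
    "(h has_field_derivative 0) (at a)" "h a = t"
    using assms unfolding critical_values_def by blast
  consider "\<kappa> = Some" | "\<kappa> = inv_chart" "a = 0" | "\<kappa> = inv_chart" "a \<noteq> 0" using h(1) by blast
  then show thesis
  proof cases
    case 1
    then show ?thesis using finite_case h by simp
  next
    case 2
    have "rat_map f None = Some t"
      using eventually_nhds_x_imp_x[OF h(2)] h(4) 2 by simp
    then have c: "coeff (fibre_poly f t) (rat_degree f) = 0" by (simp add: rat_map_None_eq_iff)
    have "coeff (fibre_poly f t) (rat_degree f - 1) = 0"
    proof (cases "rat_degree f")
      case (Suc k)
      then show ?thesis
        using critical[OF chart_polys(1) inv_chart_eq_proj h(2)[unfolded 2] h(3)[unfolded 2]
            h(4)[unfolded 2]]
        by (simp add: pderiv_0_coeff coeff_homogenize_reverse)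
    qed (use c in simp)
    then show ?thesis using c conclude(2) by blast
  next
    case 3
    have "((\<lambda>z. h (inverse z)) has_field_derivative 0 * - (inverse (inverse a) ^ Suc (Suc 0)))
      (at (inverse a))"
      using 3(2) h(3) by (intro DERIV_chain2[where g = inverse] DERIV_inverse) auto
    moreover have "\<forall>\<^sub>F z in nhds (inverse a). rat_map f (Some z) = Some (h (inverse z))"
    proof -
      have "filterlim inverse (nhds (inverse (inverse a))) (nhds (inverse a))"
        using 3(2) by (intro tendsto_inverse filterlim_ident) auto
      then have "\<forall>\<^sub>F z in nhds (inverse a). rat_map f (\<kappa> (inverse z)) = Some (h (inverse z))"
        using h(2) by (auto simp: filterlim_iff)
      moreover have "\<forall>\<^sub>F z in nhds (inverse a). z \<noteq> 0"
        using 3(2) by (intro t1_space_nhds) auto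
      ultimately show ?thesis by eventually_elim (auto simp: 3 inv_chart_def)
    qed
    ultimately show ?thesis using finite_case[of "\<lambda>z. h (inverse z)" "inverse a"] h(4) by simp
  qed
qed

text \<open>A multiple zero, at a finite point or at infinity, lowers the number of points below the
  degree. Counting points is therefore enough to recognise the values near a noncritical value as
  noncritical.\<close>

lemma noncritical_if_card_fibre:
  assumes "rat_degree f > 0" "card {x. rat_map f x = Some t} = rat_degree f"
  shows "t \<notin> critical_values f"
proof
  define m F where "m = rat_degree f" and "F = fibre_poly f t"
  have "F \<noteq> 0" "degree F \<le> m" "m > 0"
    by (simp_all add: F_def m_def fibre_poly_nonzero assms degree_fibre_poly)
  have card: "card {z. poly F z = 0} + of_bool (coeff F m = 0) = m"
    using assms by (simp add: card_fibre_eq F_def m_def)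
  assume "t \<in> critical_values f"
  then show False
  proof (cases rule: critical_value_cases)
    case (1 a)
    then have "poly F a = 0" "poly (pderiv F) a = 0" by (simp_all add: F_def)
    then obtain G where G: "F = [:- a, 1:] * G" using poly_eq_0_iff_dvd by (auto simp: dvd_def)
    then have "poly G a = 0" using \<open>poly (pderiv F) a = 0\<close>
      by (simp only: G pderiv_mult poly_add poly_mult) (simp add: pderiv_pCons)
    then have "{z. poly F z = 0} = {z. poly G z = 0}" using G by auto
    moreover have "G \<noteq> 0" using G \<open>F \<noteq> 0\<close> by auto
    moreover have "degree F = degree G + 1" using G \<open>G \<noteq> 0\<close> degree_mult_eq[of "[:- a, 1:]" G]
      by (simp del: mult_pCons_left)
    ultimately have "card {z. poly F z = 0} < degree F"
      using card_poly_roots_bound[of G] by simp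
    then show False
      using card degree_less_of_coeff_0[OF \<open>degree F \<le> m\<close> _ \<open>F \<noteq> 0\<close>] \<open>degree F \<le> m\<close>
      by (cases "coeff F m = 0") auto
  next
    case 2
    then have c: "coeff F m = 0" "coeff F (m - 1) = 0" by (simp_all add: F_def m_def)
    have "degree F < m" using degree_less_of_coeff_0[OF \<open>degree F \<le> m\<close> c(1) \<open>F \<noteq> 0\<close>] .
    then have "degree F < m - 1"
      by (intro degree_less_of_coeff_0[OF _ c(2) \<open>F \<noteq> 0\<close>]) simp
    then show False using card c card_poly_roots_bound[OF \<open>F \<noteq> 0\<close>] by simp
  qed
qed


section \<open>Local branches\<close>

text \<open>The cross product of the homogeneous coordinates is continuous and nonzero at \<open>t\<^sub>0\<close>.\<close>

lemma poly_curves_distinct_nearby: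
  assumes "poly_curve \<phi>" "poly_curve \<psi>" "isCont G t\<^sub>0" "isCont H t\<^sub>0" "\<phi> (G t\<^sub>0) \<noteq> \<psi> (H t\<^sub>0)"
  shows "\<forall>\<^sub>F t in nhds t\<^sub>0. \<phi> (G t) \<noteq> \<psi> (H t)"
proof -
  obtain A B where AB: "\<And>w. poly A w \<noteq> 0 \<or> poly B w \<noteq> 0" "\<And>w. \<phi> w = proj (poly A w) (poly B w)"
    using assms(1) unfolding poly_curve_def by blast
  obtain C D where CD: "\<And>w. poly C w \<noteq> 0 \<or> poly D w \<noteq> 0" "\<And>w. \<psi> w = proj (poly C w) (poly D w)"
    using assms(2) unfolding poly_curve_def by blast
  define e where "e t = poly A (G t) * poly D (H t) - poly C (H t) * poly B (G t)" for t
  have eq: "\<phi> (G t) = \<psi> (H t) \<longleftrightarrow> e t = 0" for t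
    using proj_eq_iff[OF AB(1) CD(1), of "G t" "H t"] AB(2) CD(2) by (simp add: e_def)
  have "isCont e t\<^sub>0" unfolding e_def using assms(3,4) by (intro continuous_intros)
  then have "\<forall>\<^sub>F t in at t\<^sub>0. e t \<noteq> 0"
    using assms(5) tendsto_imp_eventually_ne unfolding isCont_def eq by blast
  then show ?thesis using assms(5) by (simp add: eventually_nhds_conv_at eq)
qed

text \<open>The inverse function theorem in a chart around \<open>x\<close>.\<close>

lemma noncritical_local_section:
  assumes "t\<^sub>0 \<notin> critical_values f" "rat_map f x = Some t\<^sub>0"
  shows "\<exists>\<kappa> G W. \<kappa> \<in> {Some, inv_chart} \<and> open W \<and> t\<^sub>0 \<in> W \<and> G holomorphic_on W \<and>
    \<kappa> (G t\<^sub>0) = x \<and> (\<forall>t\<in>W. rat_map f (\<kappa> (G t)) = Some t)"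
proof -
  have chart_case: ?thesis
    if \<kappa>: "\<kappa> \<in> {Some, inv_chart}" "\<kappa> a = x" "\<And>w. \<kappa> w = proj (poly A w) (poly B w)"
      and nz: "\<And>w. poly A w \<noteq> 0 \<or> poly B w \<noteq> 0"
    for \<kappa> a A B
  proof -
    have t: "rat_map f (\<kappa> a) = Some t\<^sub>0" using assms(2) \<kappa>(2) by simp
    obtain S h c where h: "open S" "a \<in> S" "h holomorphic_on S"
      "\<And>w. w \<in> S \<Longrightarrow> rat_map f (\<kappa> w) = Some (h w)" "h a = t\<^sub>0" "c \<noteq> 0"
      "(h has_field_derivative
         poly (pderiv (homogenize (rat_degree f) (fibre_poly f t\<^sub>0) A B)) a / c) (at a)"
      using chart_expression[OF nz \<kappa>(3) t] by metis
    have "deriv h a \<noteq> 0"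
      using DERIV_imp_deriv[OF h(7)] noncritical_simple_root[OF assms(1) \<kappa>(1) nz \<kappa>(3) t] h(6)
      by simp
    then obtain r where r: "r > 0" "ball a r \<subseteq> S" "open (h ` ball a r)" "inj_on h (ball a r)"
      using has_complex_derivative_locally_invertible[OF h(3,2,1)] by metis
    obtain G where G: "G holomorphic_on h ` ball a r" "\<And>w. w \<in> ball a r \<Longrightarrow> G (h w) = w"
      using holomorphic_has_inverse[OF holomorphic_on_subset[OF h(3) r(2)] open_ball r(4)] by metis
    have "t\<^sub>0 \<in> h ` ball a r" "G t\<^sub>0 = a"
      using G(2)[of a] h(5) r(1) by (auto intro: rev_image_eqI[of a])
    moreover have "\<forall>t\<in>h ` ball a r. rat_map f (\<kappa> (G t)) = Some t"
      using G(2) h(4) r(2) by (auto simp: subset_iff)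
    ultimately show ?thesis using \<kappa> r(3) G(1) by blast
  qed
  show ?thesis
  proof (cases x)
    case None
    then show ?thesis
      using chart_case[of inv_chart 0, OF _ _ inv_chart_eq_proj chart_polys(1)] by simp
  next
    case (Some y)
    then show ?thesis using chart_case[of Some y, OF _ _ Some_eq_proj chart_polys(2)] by simp
  qed
qed

text \<open>The \<open>m\<close> local sections through the points of the fibre over \<open>t\<^sub>0\<close> stay distinct on a small
  disc. As no fibre has more than \<open>m\<close> points, they exhaust the fibres over that disc, and these
  fibres then have too many points for a critical value.\<close>

lemma preimage_branches_exist:
  assumes deg: "rat_degree f > 0" and t\<^sub>0: "t\<^sub>0 \<notin> critical_values f"
  obtains U z where "t\<^sub>0 \<in> U" "preimage_branches f U z"
proof -
  define m where "m = rat_degree f"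
  have "card {x. rat_map f x = Some t\<^sub>0} = m"
    using card_fibre_noncritical[OF deg t\<^sub>0] by (simp add: m_def)
  then obtain b where b: "bij_betw b {1..m} {x. rat_map f x = Some t\<^sub>0}"
    using ex_bij_betw_nat_finite_1[OF finite_fibre[OF deg]] by metis
  define sec where "sec i \<kappa> G W \<longleftrightarrow> \<kappa> \<in> {Some, inv_chart} \<and> open W \<and> t\<^sub>0 \<in> W \<and>
      G holomorphic_on W \<and> \<kappa> (G t\<^sub>0) = b i \<and> (\<forall>t\<in>W. rat_map f (\<kappa> (G t)) = Some t)" for i \<kappa> G W
  have "\<forall>i\<in>{1..m}. \<exists>\<kappa> G W. sec i \<kappa> G W"
    using noncritical_local_section[OF t\<^sub>0] bij_betwE[OF b] unfolding sec_def by blast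
  then obtain \<kappa> G W where sec: "\<And>i. i \<in> {1..m} \<Longrightarrow> sec i (\<kappa> i) (G i) (W i)"
    by metis
  have *: "\<And>i. i \<in> {1..m} \<Longrightarrow> \<kappa> i \<in> {Some, inv_chart}"
    "\<And>i. i \<in> {1..m} \<Longrightarrow> open (W i)" "\<And>i. i \<in> {1..m} \<Longrightarrow> t\<^sub>0 \<in> W i"
    "\<And>i. i \<in> {1..m} \<Longrightarrow> G i holomorphic_on W i" "\<And>i. i \<in> {1..m} \<Longrightarrow> \<kappa> i (G i t\<^sub>0) = b i"
    "\<And>i t. i \<in> {1..m} \<Longrightarrow> t \<in> W i \<Longrightarrow> rat_map f (\<kappa> i (G i t)) = Some t"
    using sec unfolding sec_def by blast+
  have curve: "poly_curve (\<kappa> i)" if "i \<in> {1..m}" for i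
    using *(1)[OF that] poly_curve_Some poly_curve_inv_chart by auto
  have cont: "isCont (G i) t\<^sub>0" if "i \<in> {1..m}" for i
    using continuous_on_eq_continuous_at[OF *(2)[OF that]] *(3)[OF that]
      holomorphic_on_imp_continuous_on[OF *(4)[OF that]] by blast
  define good where "good t \<longleftrightarrow> (\<forall>i\<in>{1..m}. t \<in> W i) \<and>
    (\<forall>i\<in>{1..m}. \<forall>j\<in>{1..m} - {i}. \<kappa> i (G i t) \<noteq> \<kappa> j (G j t))" for t
  \<comment> \<open>finitely many conditions, each of which holds near \<open>t\<^sub>0\<close>\<close>
  have "\<forall>\<^sub>F t in nhds t\<^sub>0. good t"
    unfolding good_def
  proof (intro eventually_conj eventually_ball_finite ballI)
    fix i assume i: "i \<in> {1..m}"
    show "\<forall>\<^sub>F t in nhds t\<^sub>0. t \<in> W i"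
      by (rule eventually_nhds_in_open[OF *(2)[OF i] *(3)[OF i]])
    fix j assume "j \<in> {1..m} - {i}"
    then have j: "j \<in> {1..m}" "i \<noteq> j" by auto
    have "b i \<noteq> b j" using inj_onD[OF bij_betw_imp_inj_on[OF b] _ i j(1)] j(2) by blast
    then have "\<kappa> i (G i t\<^sub>0) \<noteq> \<kappa> j (G j t\<^sub>0)"
      unfolding *(5)[OF i] *(5)[OF j(1)] .
    with curve[OF i] curve[OF j(1)] cont[OF i] cont[OF j(1)]
    show "\<forall>\<^sub>F t in nhds t\<^sub>0. \<kappa> i (G i t) \<noteq> \<kappa> j (G j t)"
      by (rule poly_curves_distinct_nearby)
  qed auto
  then obtain e where e: "e > 0" "\<And>t. t \<in> ball t\<^sub>0 e \<Longrightarrow> good t"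
    unfolding eventually_nhds_metric by (metis dist_commute mem_ball)
  define z where "z i t = \<kappa> i (G i t)" for i t
  have bij: "bij_betw (\<lambda>i. z i t) {1..m} {x. rat_map f x = Some t}" if "t \<in> ball t\<^sub>0 e" for t
  proof -
    have inj: "inj_on (\<lambda>i. z i t) {1..m}"
      using e(2)[OF that] unfolding good_def z_def inj_on_def by blast
    have "(\<lambda>i. z i t) ` {1..m} \<subseteq> {x. rat_map f x = Some t}"
      using e(2)[OF that] *(6)[of _ t] unfolding good_def z_def by blast
    moreover have "card {x. rat_map f x = Some t} \<le> card ((\<lambda>i. z i t) ` {1..m})"
      unfolding card_image[OF inj] using card_fibre_le[OF deg] by (simp add: m_def)
    ultimately have "(\<lambda>i. z i t) ` {1..m} = {x. rat_map f x = Some t}"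
      using card_seteq[OF finite_fibre[OF deg]] by blast
    with inj show ?thesis by (simp add: bij_betw_def)
  qed
  have "preimage_branches f (ball t\<^sub>0 e) z"
    unfolding preimage_branches_def
  proof (intro conjI ballI)
    show "ball t\<^sub>0 e \<subseteq> - critical_values f"
      using bij_betw_same_card[OF bij] noncritical_if_card_fibre[OF deg] by (fastforce simp: m_def)
    fix i assume i: "i \<in> {1..rat_degree f}"
    show "sphere_analytic_on (z i) (ball t\<^sub>0 e)"
      unfolding sphere_analytic_on_def
    proof
      fix t assume "t \<in> ball t\<^sub>0 e"
      then have "t \<in> W i" using e(2) i by (auto simp: good_def m_def)
      then have "G i analytic_on {t}"
        using holomorphic_on_imp_analytic_at[OF *(4) *(2)] i by (simp add: m_def)
      then show "\<exists>\<kappa>\<in>{Some, inv_chart}. \<exists>h. h analytic_on {t} \<and> (\<forall>\<^sub>F s in nhds t. z i s = \<kappa> (h s))"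
        using *(1)[of i] i unfolding z_def m_def by (intro bexI[of _ "\<kappa> i"] exI[of _ "G i"]) auto
    qed
  next
    fix t assume "t \<in> ball t\<^sub>0 e"
    then show "bij_betw (\<lambda>i. z i t) {1..rat_degree f} {x. rat_map f x = Some t}"
      using bij by (simp add: m_def)
  qed auto
  then show thesis using that[of "ball t\<^sub>0 e" z] e(1) by simp
qed

lemma branch_continuation_const:
  assumes "t\<^sub>0 \<in> U" "preimage_branches f U z"
  shows "branch_continuation f U z (\<lambda>_. t\<^sub>0) (\<lambda>_. U) (\<lambda>_. z)"
  using assms unfolding branch_continuation_def
  by (auto simp: preimage_branches_def path_def path_image_def)

section \<open>Integrals over simple cycles\<close>

definition simple_cycle :: "nat \<Rightarrow> nat \<Rightarrow> nat \<Rightarrow> int" where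
  "simple_cycle i j k = of_bool (k = j) - of_bool (k = i)"

lemma is_simple_cycle_simple_cycle:
  "i \<in> {1..m} \<Longrightarrow> j \<in> {1..m} \<Longrightarrow> is_simple_cycle m (simple_cycle i j)"
  unfolding is_simple_cycle_def simple_cycle_def by blast

lemma is_cycle_if_is_simple_cycle:
  assumes "is_simple_cycle m n"
  shows "is_cycle m n"
proof -
  obtain i j where "i \<in> {1..m}" "j \<in> {1..m}" "\<And>k. k \<in> {1..m} \<Longrightarrow> n k = of_bool (k = j) - of_bool (k = i)"
    using assms unfolding is_simple_cycle_def by blast
  then show ?thesis by (simp add: is_cycle_def sum_subtractf of_bool_def)
qed

lemma abelian_integral_simple_cycle:
  assumes "i \<in> {1..m}" "j \<in> {1..m}"
  shows "abelian_integral g m (simple_cycle i j) x = the (rat_map g (x j)) - the (rat_map g (x i))"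
proof -
  have "abelian_integral g m (simple_cycle i j) x =
      (\<Sum>k=1..m. (if k = j then the (rat_map g (x j)) else 0) - (if k = i then the (rat_map g (x i)) else 0))"
    unfolding abelian_integral_def simple_cycle_def by (intro sum.cong) auto
  also have "\<dots> = the (rat_map g (x j)) - the (rat_map g (x i))"
    using assms by (simp add: sum_subtractf)
  finally show ?thesis .
qed

text \<open>The integral is the difference of the values of \<open>g\<close> at two branches. The case \<open>i = j\<close>, where the
  cycle is \<open>0\<close> and poles do not matter, agrees because the conclusion is trivial.\<close>

lemma integral_simple_cycle_vanishes_iff:
  assumes "i \<in> {1..rat_degree f}" "j \<in> {1..rat_degree f}"
  shows "integral_vanishes f t\<^sub>0 U z (simple_cycle i j) g \<longleftrightarrow>
    (\<forall>\<gamma> V w. pathstart \<gamma> = t\<^sub>0 \<and> branch_continuation f U z \<gamma> V w \<longrightarrow>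
      (\<forall>s\<in>{0..1}. \<forall>t\<in>V s. rat_map g (w s i t) \<noteq> None \<and> rat_map g (w s j t) \<noteq> None \<longrightarrow>
         rat_map g (w s i t) = rat_map g (w s j t)))"
proof -
  have support: "(\<forall>k\<in>{1..rat_degree f}. simple_cycle i j k \<noteq> 0 \<longrightarrow> Q k) \<longleftrightarrow> i = j \<or> (Q i \<and> Q j)" for Q
    using assms by (auto simp: simple_cycle_def)
  have "((\<forall>k\<in>{1..rat_degree f}. simple_cycle i j k \<noteq> 0 \<longrightarrow> rat_map g (x k) \<noteq> None) \<longrightarrow>
      abelian_integral g (rat_degree f) (simple_cycle i j) x = 0) \<longleftrightarrow>
      (rat_map g (x i) \<noteq> None \<and> rat_map g (x j) \<noteq> None \<longrightarrow> rat_map g (x i) = rat_map g (x j))"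
    for x
    unfolding abelian_integral_simple_cycle[OF assms] support by auto
  then show ?thesis unfolding integral_vanishes_def by presburger
qed

text \<open>The points of a fibre where \<open>g\<close> has a pole can be ignored, because the condition at \<open>t\<close> is only
  imposed if \<open>g\<close> is finite at all points with a nonzero coefficient, and only these are compared
  with one another.\<close>

lemma integral_cycle_vanishes:
  assumes simple: "\<And>i j. i \<in> {1..rat_degree f} \<Longrightarrow> j \<in> {1..rat_degree f} \<Longrightarrow>
      integral_vanishes f t\<^sub>0 U z (simple_cycle i j) g"
    and "is_cycle (rat_degree f) n"
  shows "integral_vanishes f t\<^sub>0 U z n g"
  unfolding integral_vanishes_def
proof (intro allI impI ballI, elim conjE)
  fix \<gamma> V w s t
  assume cont: "pathstart \<gamma> = t\<^sub>0" "branch_continuation f U z \<gamma> V w" and st: "s \<in> {0..1}" "t \<in> V s"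
    and finite: "\<forall>i\<in>{1..rat_degree f}. n i \<noteq> 0 \<longrightarrow> rat_map g (w s i t) \<noteq> None"
  let ?m = "rat_degree f"
  have eq: "rat_map g (w s i t) = rat_map g (w s j t)"
    if "i \<in> {1..?m}" "j \<in> {1..?m}" "n i \<noteq> 0" "n j \<noteq> 0" for i j
    using integral_simple_cycle_vanishes_iff[OF that(1,2), THEN iffD1, OF simple[OF that(1,2)],
        rule_format, of \<gamma> V w s t] cont st finite that by blast
  obtain c where c: "\<And>i. i \<in> {1..?m} \<Longrightarrow> n i \<noteq> 0 \<Longrightarrow> the (rat_map g (w s i t)) = c"
  proof (cases "\<exists>i\<in>{1..?m}. n i \<noteq> 0")
    case True
    then obtain i where i: "i \<in> {1..?m}" "n i \<noteq> 0" by blast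
    show thesis
      by (rule that[of "the (rat_map g (w s i t))"]) (use eq[OF _ i(1) _ i(2)] in simp)
  qed (use that in blast)
  have "abelian_integral g ?m n (\<lambda>i. w s i t) = (\<Sum>i=1..?m. of_int (n i) * c)"
    unfolding abelian_integral_def
  proof (intro sum.cong refl)
    fix i assume "i \<in> {1..?m}"
    then show "of_int (n i) * the (rat_map g (w s i t)) = of_int (n i) * c"
      using c by (cases "n i = 0") auto
  qed
  also have "\<dots> = of_int (\<Sum>i=1..?m. n i) * c" by (simp add: sum_distrib_right)
  also have "\<dots> = 0" using assms(2) by (simp add: is_cycle_def)
  finally show "abelian_integral g ?m n (\<lambda>i. w s i t) = 0" .
qed

lemma integral_simple_cycle_vanishes_of_comp:
  assumes g: "rat_map g = rat_map g\<^sub>0 \<circ> rat_map f"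
    and ij: "i \<in> {1..rat_degree f}" "j \<in> {1..rat_degree f}"
  shows "integral_vanishes f t\<^sub>0 U z (simple_cycle i j) g"
  unfolding integral_simple_cycle_vanishes_iff[OF ij]
proof (intro allI impI ballI, elim conjE)
  fix \<gamma> V w s t
  assume "branch_continuation f U z \<gamma> V w" and "s \<in> {0..1}" "t \<in> V s"
  then have "bij_betw (\<lambda>i. w s i t) {1..rat_degree f} {x. rat_map f x = Some t}"
    unfolding branch_continuation_def preimage_branches_def by blast
  then have "rat_map f (w s i t) = Some t" "rat_map f (w s j t) = Some t"
    using bij_betwE ij by blast+
  then show "rat_map g (w s i t) = rat_map g (w s j t)" by (simp add: g)
qed

section \<open>From vanishing integrals to a composition\<close>

text \<open>The quotient \<open>C/D\<close> may be unreduced; a common factor does not vanish at \<open>t\<close> and cancels.\<close>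

lemma rat_map_Fract_finite:
  assumes "poly D t \<noteq> 0"
  shows "rat_map (Fract C D) (Some t) = Some (poly C t / poly D t)"
proof -
  define k where "k = Fract C D"
  have "D \<noteq> 0" using assms by auto
  have "Fract (rat_num k) (rat_denom k) = Fract C D"
    by (simp add: rat_num_def rat_denom_def k_def)
  then have "rat_num k * D = C * rat_denom k"
    using \<open>D \<noteq> 0\<close> by (simp add: eq_fract)
  then have eq: "poly (rat_num k) t * poly D t = poly C t * poly (rat_denom k) t"
    by (metis poly_mult)
  then have "poly (rat_denom k) t \<noteq> 0" using rat_no_common_root[of k t] assms by auto
  then have "rat_map k (Some t) = Some (poly C t / poly D t)"
    using eq assms by (simp add: rat_map_def Let_def frac_eq_eq)
  then show ?thesis by (simp add: k_def)
qed

text \<open>The constant path suffices as continuation. Excluding from \<open>U\<close> the images under \<open>f\<close> of infinity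
  and of the finite poles of \<open>g\<close> leaves values over which the fibre has \<open>m\<close> finite points and \<open>g\<close> is
  finite on all of them.\<close>

lemma comp_of_simple_integrals_vanish:
  assumes deg: "rat_degree f > 0" and U: "t\<^sub>0 \<in> U" and branches: "preimage_branches f U z"
    and simple: "\<And>i j. i \<in> {1..rat_degree f} \<Longrightarrow> j \<in> {1..rat_degree f} \<Longrightarrow>
      integral_vanishes f t\<^sub>0 U z (simple_cycle i j) g"
  shows "\<exists>g\<^sub>0. rat_map g = rat_map g\<^sub>0 \<circ> rat_map f"
proof -
  define m where "m = rat_degree f"
  have bij: "bij_betw (\<lambda>i. z i t) {1..m} {x. rat_map f x = Some t}" if "t \<in> U" for t
    using branches that by (simp add: preimage_branches_def m_def)
  have g_eq: "rat_map g x = rat_map g y"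
    if t: "t \<in> U" and xy: "rat_map f x = Some t" "rat_map f y = Some t"
      and finite: "rat_map g x \<noteq> None" "rat_map g y \<noteq> None"
    for t x y
  proof -
    obtain i j where ij: "i \<in> {1..m}" "j \<in> {1..m}" "x = z i t" "y = z j t"
      using bij_betw_imp_surj_on[OF bij[OF t]] xy by blast
    then have "i \<in> {1..rat_degree f}" "j \<in> {1..rat_degree f}" by (simp_all add: m_def)
    from integral_simple_cycle_vanishes_iff[OF this, THEN iffD1, OF simple[OF this],
        rule_format, of "\<lambda>_. t\<^sub>0" "\<lambda>_. U" "\<lambda>_. z" 0 t]
    show ?thesis
      using branch_continuation_const[OF U branches] t finite ij by (simp add: pathstart_def)
  qed
  define bad where "bad = insert None (Some ` {y. poly (rat_denom g) y = 0})"
  define T where "T = U - (the \<circ> rat_map f) ` bad"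
  have "finite bad" by (simp add: bad_def poly_roots_finite)
  moreover have "infinite U"
    using branches U by (metis empty_iff finite_imp_not_open preimage_branches_def)
  ultimately have "infinite T" unfolding T_def by (intro Diff_infinite_finite finite_imageI)
  have not_bad: "x \<notin> bad" if "t \<in> T" "rat_map f x = Some t" for x t
    using that by (force simp: T_def)
  define h where "h t = the (rat_map g (z 1 t))" for t
  have h: "rat_map g x = Some (h t)" if t: "t \<in> T" and x: "rat_map f x = Some t" for x t
  proof -
    have finite: "rat_map g y \<noteq> None" if "rat_map f y = Some t" for y
      using not_bad[OF t that]
      by (cases y) (auto simp: bad_def rat_map_def Let_def)
    have "t \<in> U" using t by (simp add: T_def)
    moreover have "rat_map f (z 1 t) = Some t"
      using bij_betwE[OF bij[OF \<open>t \<in> U\<close>]] deg by (auto simp: m_def)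
    ultimately show ?thesis using g_eq[of t x "z 1 t"] finite[of x] finite[of "z 1 t"] x
      by (auto simp: h_def)
  qed
  have fibre: "poly (rat_num f) y = t * poly (rat_denom f) y \<longleftrightarrow> rat_map f (Some y) = Some t" for t y
    by (simp add: rat_map_Some_eq_iff fibre_poly_def)
  have card: "card {y. poly (rat_num f) y = t * poly (rat_denom f) y} = m" if "t \<in> T" for t
  proof -
    have "card {x. rat_map f x = Some t} = m"
      using bij_betw_same_card[OF bij, of t] that by (simp add: T_def)
    moreover have "{x. rat_map f x = Some t} = Some ` {y. rat_map f (Some y) = Some t}"
    proof -
      have "rat_map f None \<noteq> Some t" using not_bad[OF that] by (auto simp: bad_def)
      then have "rat_map f x = Some t \<Longrightarrow> x \<in> Some ` {y. rat_map f (Some y) = Some t}" for x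
        by (cases x) auto
      then show ?thesis by auto
    qed
    ultimately show ?thesis by (simp add: fibre card_image)
  qed
  have "\<exists>C D. D \<noteq> 0 \<and> (\<forall>t\<in>T. poly C t = h t * poly D t)"
  proof (rule fibrewise_constant_imp_rational[OF degree_rat_num degree_rat_denom deg \<open>infinite T\<close>])
    show "card {y. poly (rat_num f) y = t * poly (rat_denom f) y} = rat_degree f" if "t \<in> T" for t
      using card[OF that] by (simp add: m_def)
    fix t y assume t: "t \<in> T" and y: "poly (rat_num f) y = t * poly (rat_denom f) y"
    show "poly (rat_denom f) y \<noteq> 0" using rat_no_common_root[of f y] y by auto
    show Q: "poly (rat_denom g) y \<noteq> 0"
      using not_bad[OF t, of "Some y"] y fibre by (auto simp: bad_def)
    show "poly (rat_num g) y = h t * poly (rat_denom g) y"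
      using h[OF t, of "Some y"] y fibre Q by (auto simp: rat_map_def Let_def field_simps)
  qed
  then obtain C D where D: "D \<noteq> 0" and CD: "\<And>t. t \<in> T \<Longrightarrow> poly C t = h t * poly D t" by blast
  define k where "k = Fract C D"
  define T' where "T' = T - {t. poly D t = 0}"
  have "infinite T'"
    unfolding T'_def using \<open>infinite T\<close> D by (intro Diff_infinite_finite poly_roots_finite)
  \<comment> \<open>\<open>f\<close> maps the points of agreement onto a set containing \<open>T'\<close>, so there are infinitely many\<close>
  have "T' \<subseteq> (\<lambda>y. the (rat_map f (Some y))) ` {y. rat_map g (Some y) = rat_map k (rat_map f (Some y))}"
  proof
    fix t assume "t \<in> T'"
    then have t: "t \<in> T" "poly D t \<noteq> 0" by (auto simp: T'_def)
    have "{y. rat_map f (Some y) = Some t} \<noteq> {}"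
      using card[OF t(1)] deg unfolding fibre m_def by (metis card.empty less_irrefl)
    then obtain y where y: "rat_map f (Some y) = Some t" by blast
    have "rat_map k (Some t) = Some (h t)"
      using rat_map_Fract_finite[OF t(2), of C] CD[OF t(1)] t(2) by (simp add: k_def)
    then have "rat_map g (Some y) = rat_map k (rat_map f (Some y))" using h[OF t(1) y] y by simp
    then show "t \<in> (\<lambda>y. the (rat_map f (Some y))) ` {y. rat_map g (Some y) = rat_map k (rat_map f (Some y))}"
      using y by (intro image_eqI[of _ _ y]) auto
  qed
  then have "infinite {y. rat_map g (Some y) = rat_map k (rat_map f (Some y))}"
    using \<open>infinite T'\<close> finite_subset by blast
  then show ?thesis using rat_map_comp_eqI by blast
qed

section \<open>The equivalence\<close>

lemma integral_vanishes_cong: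
  assumes "\<And>i. i \<in> {1..rat_degree f} \<Longrightarrow> n i = n' i"
  shows "integral_vanishes f t\<^sub>0 U z n g \<longleftrightarrow> integral_vanishes f t\<^sub>0 U z n' g"
proof -
  have "abelian_integral g (rat_degree f) n x = abelian_integral g (rat_degree f) n' x" for x
    unfolding abelian_integral_def using assms by (intro sum.cong) auto
  then show ?thesis unfolding integral_vanishes_def using assms by simp
qed

theorem theorem2p1:
  fixes f g :: ratfun and m :: nat and t\<^sub>0 :: complex
  assumes "rat_degree f = m" and "m > 1"
    and "t\<^sub>0 \<notin> critical_values f"
  shows "((\<forall>U z n. t\<^sub>0 \<in> U \<and> preimage_branches f U z \<and> is_cycle m n
              \<longrightarrow> integral_vanishes f t\<^sub>0 U z n g)
          \<longleftrightarrow> (\<forall>U z n. t\<^sub>0 \<in> U \<and> preimage_branches f U z \<and> is_simple_cycle m n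
              \<longrightarrow> integral_vanishes f t\<^sub>0 U z n g)) \<and>
         ((\<forall>U z n. t\<^sub>0 \<in> U \<and> preimage_branches f U z \<and> is_simple_cycle m n
              \<longrightarrow> integral_vanishes f t\<^sub>0 U z n g)
          \<longleftrightarrow> (\<exists>g\<^sub>0 :: ratfun. rat_map g = rat_map g\<^sub>0 \<circ> rat_map f))"
    (is "(?cycles \<longleftrightarrow> ?simple) \<and> (?simple \<longleftrightarrow> ?comp)")
proof (intro conjI iffI)
  assume ?cycles
  then show ?simple using is_cycle_if_is_simple_cycle by blast
next
  assume ?simple
  show ?cycles
  proof (intro allI impI, elim conjE)
    fix U z n assume "t\<^sub>0 \<in> U" "preimage_branches f U z" "is_cycle m n"
    then have "integral_vanishes f t\<^sub>0 U z (simple_cycle i j) g" if "i \<in> {1..m}" "j \<in> {1..m}" for i j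
      using \<open>?simple\<close> is_simple_cycle_simple_cycle[OF that] by blast
    then show "integral_vanishes f t\<^sub>0 U z n g"
      using \<open>is_cycle m n\<close> unfolding assms(1)[symmetric] by (rule integral_cycle_vanishes)
  qed
next
  assume ?simple
  have deg: "rat_degree f > 0" using assms(1,2) by simp
  then obtain U z where Uz: "t\<^sub>0 \<in> U" "preimage_branches f U z"
    using preimage_branches_exist assms(3) by blast
  have "integral_vanishes f t\<^sub>0 U z (simple_cycle i j) g"
    if "i \<in> {1..rat_degree f}" "j \<in> {1..rat_degree f}" for i j
    using \<open>?simple\<close> Uz is_simple_cycle_simple_cycle[OF that] unfolding assms(1) by blast
  then show ?comp by (rule comp_of_simple_integrals_vanish[OF deg Uz])
next
  assume ?comp
  then obtain g\<^sub>0 where g: "rat_map g = rat_map g\<^sub>0 \<circ> rat_map f" by blast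
  show ?simple
  proof (intro allI impI, elim conjE)
    fix U z n assume "is_simple_cycle m n"
    then obtain i j where ij: "i \<in> {1..m}" "j \<in> {1..m}"
      and n: "\<And>k. k \<in> {1..m} \<Longrightarrow> n k = simple_cycle i j k"
      unfolding is_simple_cycle_def simple_cycle_def by blast
    have "integral_vanishes f t\<^sub>0 U z (simple_cycle i j) g"
      using integral_simple_cycle_vanishes_of_comp[OF g] ij unfolding assms(1)[symmetric] by blast
    then show "integral_vanishes f t\<^sub>0 U z n g"
      using integral_vanishes_cong[of f n "simple_cycle i j"] n assms(1) by blast
  qed
qed

end
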